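(* For any $n\in\mathbb{Z}_{>0}$ and $r>0$, $$B_r(\mathbb{S}^{n-1}_\infty,\mathbb{R}^n_\infty)\simeq B_r(\mathbb{S}^{n-1}_\infty,\mathbb{D}^n_\infty)=\mathbb{D}^n_\infty\setminus V_{n,r},$$ where $\simeq$ denotes homotopy equivalence and $$V_{n,r}:=\bigcap_{(p_1,\dots,p_n)\in\{r,-r\}^n}\left\{(x_1,\dots,x_n)\in\mathbb{R}^n:\sum_{i=1}^n(x_i-p_i)^2\le1\right\}.$$ In particular, for $r>\frac1{\sqrt n}$ we have $V_{n,r}=\emptyset$, so that $B_r(\mathbb{S}^{n-1}_\infty,\mathbb{D}^n_\infty)=\mathbb{D}^n_\infty$. As a result, $B_r(\mathbb{S}^{n-1}_\infty,\mathbb{R}^n_\infty)$ is homotopy equivalent to $\mathbb{S}^{n-1}$ for $r\in\left(0,\frac1{\sqrt n}\right]$ and contractible for $r>\frac1{\sqrt n}$.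
   Context: $\mathbb{R}^n_\infty$ is $\mathbb{R}^n$ with the $\ell^\infty$-metric. $\mathbb{D}^n_\infty=\{x\in\mathbb{R}^n:\sum_{i=1}^n x_i^2\le1\}$ and $\mathbb{S}^{n-1}_\infty=\{x\in\mathbb{R}^n:\sum_{i=1}^n x_i^2=1\}$, both with the restriction of the $\ell^\infty$-metric. For a subset $X$ of a metric space $(E,d_E)$, $B_r(X,E)=\{z\in E:\exists x\in X,\ d_E(z,x)<r\}$ is the open $r$-neighborhood. *)

theory Defs
  imports "HOL-Analysis.Analysis"
begin

text \<open>
  The ambient space is \<open>real ^ 'n\<close> with \<open>n = CARD('n)\<close>, so that \<open>n > 0\<close> holds automatically. On this
  type \<open>infnorm\<close> is the supremum of the absolute values of the coordinates.
\<close>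

definition linf_dist :: "real ^ 'n \<Rightarrow> real ^ 'n \<Rightarrow> real" where
  "linf_dist x y = infnorm (x - y)"

lemma linf_dist_Max:
  "linf_dist x y = Max (range (\<lambda>i. \<bar>x $ i - y $ i\<bar>))"
proof -
  have "{\<bar>(x - y) $ i\<bar> | i. i \<in> UNIV} = range (\<lambda>i. \<bar>x $ i - y $ i\<bar>)"
    by auto
  then show ?thesis
    unfolding linf_dist_def infnorm_cart by (simp add: cSup_eq_Max)
qed

lemma Metric_space_linf: "Metric_space A linf_dist"
proof
  fix x y z :: "real ^ 'n"
  show "0 \<le> linf_dist x y"
    by (simp add: linf_dist_def infnorm_pos_le)
  show "linf_dist x y = linf_dist y x"
    by (simp add: linf_dist_def infnorm_sub)
  show "linf_dist x y = 0 \<longleftrightarrow> x = y"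
    by (simp add: linf_dist_def infnorm_eq_0)
  show "linf_dist x z \<le> linf_dist x y + linf_dist y z"
    using infnorm_triangle[of "x - y" "y - z"] by (simp add: linf_dist_def)
qed

text \<open>The topology on \<open>A\<close> induced by the restricted \<open>\<ell>\<^sup>\<infinity>\<close>-metric.\<close>

definition linf_topology :: "(real ^ 'n) set \<Rightarrow> (real ^ 'n) topology" where
  "linf_topology A = Metric_space.mtopology A linf_dist"

definition linf_disk :: "(real ^ 'n) set" where
  "linf_disk = {x. (\<Sum>i\<in>UNIV. (x $ i)\<^sup>2) \<le> 1}"

definition linf_sphere :: "(real ^ 'n) set" where
  "linf_sphere = {x. (\<Sum>i\<in>UNIV. (x $ i)\<^sup>2) = 1}"

definition open_nbhd :: "('a \<Rightarrow> 'a \<Rightarrow> real) \<Rightarrow> real \<Rightarrow> 'a set \<Rightarrow> 'a set \<Rightarrow> 'a set" where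
  "open_nbhd d r X E = {z \<in> E. \<exists>x\<in>X. d z x < r}"

abbreviation linf_nbhd :: "real \<Rightarrow> (real ^ 'n) set \<Rightarrow> (real ^ 'n) set \<Rightarrow> (real ^ 'n) set" where
  "linf_nbhd \<equiv> open_nbhd linf_dist"

definition V :: "real \<Rightarrow> (real ^ 'n) set" where
  "V r = (\<Inter>p \<in> {p. \<forall>i. p $ i \<in> {r, -r}}. {x. (\<Sum>i\<in>UNIV. (x $ i - p $ i)\<^sup>2) \<le> 1})"

end

theory Submission
  imports Defs
begin

text \<open>
  Let \<open>N\<close> be the open \<open>r\<close>-neighbourhood of the sphere in the whole space. If \<open>z \<in> N\<close> lies outside the
  disk and \<open>x\<close> is a sphere point near \<open>z\<close>, then for \<open>0 \<le> t \<le> 1\<close> with \<open>\<bar>tz\<bar> \<ge> 1\<close> the segment from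
  \<open>tx\<close> to \<open>tz\<close> meets the sphere, so \<open>tz \<in> N\<close>. Hence \<open>N\<close> retracts radially onto its part in the disk.
  A point \<open>z\<close> of the disk is at \<open>\<ell>\<^sup>\<infinity>\<close>-distance at least \<open>r\<close> from the sphere iff the cube of radius \<open>r\<close>
  around \<open>z\<close> has all its vertices in the disk, that is, iff \<open>z \<in> V r\<close>. If \<open>r \<le> 1 / \<surd>n\<close>, then \<open>V r\<close>
  is convex and contains \<open>0\<close>, so its complement in the disk retracts radially onto the sphere.
\<close>

section \<open>Reduction of topology, disk, sphere and \<open>V\<close> to Euclidean terms\<close>

lemma linf_topology_eq: "linf_topology (A :: (real ^ 'n) set) = top_of_set A"
proof -
  interpret U: Metric_space "UNIV :: (real ^ 'n) set" linf_dist
    by (rule Metric_space_linf)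
  interpret S: Submetric "UNIV :: (real ^ 'n) set" linf_dist A
    by unfold_locales auto
  let ?c = "sqrt (real DIM(real ^ 'n))"
  have c: "?c > 0"
    by simp
  \<comment> \<open>Since \<open>infnorm\<close> is at most \<open>norm\<close>, and
    \<open>norm\<close> at most \<open>?c\<close> times \<open>infnorm\<close>, each ball of one
    metric contains a concentric ball of the other. The comparison is made on the whole space and
    then restricted to \<open>A\<close> by the submetric.\<close>
  have "openin U.mtopology W \<longleftrightarrow> open W" for W
  proof
    assume W: "openin U.mtopology W"
    show "open W"
      unfolding open_contains_ball
    proof
      fix x assume "x \<in> W"
      then obtain e where e: "e > 0" "U.mball x e \<subseteq> W"
        using W unfolding U.openin_mtopology by blast
      have "ball x e \<subseteq> U.mball x e"
        unfolding ball_def U.mball_def dist_norm linf_dist_def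
        using infnorm_le_norm order.strict_trans1 by blast
      with e show "\<exists>e>0. ball x e \<subseteq> W"
        by blast
    qed
  next
    assume W: "open W"
    have "\<exists>e>0. U.mball x e \<subseteq> W" if xW: "x \<in> W" for x
    proof -
      obtain e where e: "e > 0" "ball x e \<subseteq> W"
        using W xW by (rule openE)
      have "dist x y < e" if "linf_dist x y < e / ?c" for y
      proof -
        have "norm (x - y) \<le> ?c * infnorm (x - y)"
          by (rule norm_le_infnorm)
        also have "\<dots> < e"
          using that c by (simp add: linf_dist_def field_simps)
        finally show ?thesis
          by (simp add: dist_norm)
      qed
      then have "U.mball x (e / ?c) \<subseteq> W"
        using e by auto
      then show ?thesis
        using e c by (intro exI[of _ "e / ?c"]) auto
    qed
    then show "openin U.mtopology W"
      unfolding U.openin_mtopology by auto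
  qed
  then have "U.mtopology = euclidean"
    by (simp add: topology_eq)
  then show ?thesis
    unfolding linf_topology_def using S.mtopology_submetric by simp
qed

lemma norm_sq_cart: "(norm (x :: real ^ 'n))\<^sup>2 = (\<Sum>i\<in>UNIV. (x $ i)\<^sup>2)"
  by (simp add: norm_vec_def L2_set_def sum_nonneg)

lemma linf_disk_eq: "linf_disk = cball (0 :: real ^ 'n) 1"
  by (auto simp: linf_disk_def abs_square_le_1 simp flip: norm_sq_cart)

lemma linf_sphere_eq: "linf_sphere = sphere (0 :: real ^ 'n) 1"
  by (auto simp: linf_sphere_def power2_eq_1_iff simp flip: norm_sq_cart)
     (smt (verit) norm_ge_zero)

lemma V_iff: "z \<in> V r \<longleftrightarrow> (\<forall>p. (\<forall>i. p $ i \<in> {r, -r}) \<longrightarrow> norm (z - p) \<le> 1)"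
  by (simp add: V_def abs_square_le_1 flip: norm_sq_cart vector_minus_component)

text \<open>Exhibits \<open>V r\<close> as an intersection of balls, from which its convexity is
  read off later.\<close>

lemma V_eq: "V r = (\<Inter>p \<in> {p. \<forall>i. p $ i \<in> {r, -r}}. cball p 1)"
  by (auto simp: V_iff dist_norm norm_minus_commute)

lemma mem_linf_nbhd_sphere:
  "z \<in> linf_nbhd r linf_sphere E \<longleftrightarrow> z \<in> E \<and> (\<exists>x. norm x = 1 \<and> infnorm (z - x) < r)"
  by (auto simp: open_nbhd_def linf_sphere_eq linf_dist_def)

lemma infnorm_le_cart: "(\<And>i. \<bar>x $ i\<bar> \<le> c) \<Longrightarrow> infnorm (x :: real ^ 'n) \<le> c"
  unfolding infnorm_cart by (rule cSup_least) auto

section \<open>Sphere crossings and straight-line retractions\<close>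

lemma norm_eq_1_on_segment:
  fixes a b :: "'a :: real_normed_vector"
  assumes "norm a \<le> 1" "1 \<le> norm b"
  obtains s where "0 \<le> s" "s \<le> 1" "norm (b + s *\<^sub>R (a - b)) = 1"
proof -
  \<comment> \<open>Intermediate value theorem for the norm along the segment: it is at least 1 at
    \<open>s = 0\<close> (the point \<open>b\<close>) and at most 1 at \<open>s = 1\<close> (the
    point \<open>a\<close>).\<close>
  have "\<exists>s\<ge>0. s \<le> 1 \<and> norm (b + s *\<^sub>R (a - b)) = 1"
    by (rule IVT2') (use assms in \<open>auto intro!: continuous_intros\<close>)
  then show ?thesis
    using that by blast
qed

lemma linear_deformation_retract_imp_homotopy_eqv:
  fixes S T :: "'a :: euclidean_space set"
  assumes "T \<subseteq> S" "continuous_on S f" "f \<in> S \<rightarrow> T" "\<And>x. x \<in> T \<Longrightarrow> f x = x"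
    and "\<And>x. x \<in> S \<Longrightarrow> closed_segment x (f x) \<subseteq> S"
  shows "S homotopy_eqv T"
proof (rule deformation_retract_imp_homotopy_eqv)
  show "homotopic_with_canon (\<lambda>x. True) S S id f"
    by (rule homotopic_with_linear) (use assms in \<open>auto simp: continuous_on_id\<close>)
  show "retraction S T f"
    using assms by (auto simp: retraction_def)
qed

text \<open>Both retractions below are radial, \<open>z\<close> going to
  \<open>c *\<^sub>R z\<close>, so containment of their homotopy tracks becomes a statement about
  scalars between 1 and \<open>c\<close>.\<close>

lemma mem_segment_to_multiple:
  fixes z :: "'a :: real_vector"
  assumes "y \<in> closed_segment z (c *\<^sub>R z)"
  obtains t where "y = t *\<^sub>R z" "min 1 c \<le> t" "t \<le> max 1 c"
proof -
  obtain u where u: "0 \<le> u" "u \<le> 1" "y = (1 - u) *\<^sub>R z + u *\<^sub>R c *\<^sub>R z"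
    using assms by (auto simp: in_segment)
  have "(1 - u) + u * c \<in> closed_segment 1 c"
    using u by (auto simp: in_segment)
  then have "min 1 c \<le> (1 - u) + u * c" "(1 - u) + u * c \<le> max 1 c"
    by (auto simp: closed_segment_eq_real_ivl split: if_splits)
  moreover have "y = ((1 - u) + u * c) *\<^sub>R z"
    using u by (simp add: algebra_simps)
  ultimately show ?thesis
    using that by blast
qed

text \<open>The point where the segment between \<open>t *\<^sub>R z\<close> and
  \<open>t *\<^sub>R x\<close> crosses the sphere is at distance
  \<open>s * t * infnorm (z - x)\<close> from \<open>t *\<^sub>R z\<close>, and both factors
  \<open>s\<close> and \<open>t\<close> are at most 1.\<close>

lemma scaleR_mem_linf_nbhd_sphere:
  fixes z :: "real ^ 'n"
  assumes z: "z \<in> linf_nbhd r linf_sphere UNIV" and t: "0 \<le> t" "t \<le> 1" "1 \<le> norm (t *\<^sub>R z)"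
  shows "t *\<^sub>R z \<in> linf_nbhd r linf_sphere UNIV"
proof -
  obtain x where x: "norm x = 1" "infnorm (z - x) < r"
    using z by (auto simp: mem_linf_nbhd_sphere)
  obtain s where s: "0 \<le> s" "s \<le> 1" "norm (t *\<^sub>R z + s *\<^sub>R (t *\<^sub>R x - t *\<^sub>R z)) = 1"
    using t x by (auto intro: norm_eq_1_on_segment[of "t *\<^sub>R x" "t *\<^sub>R z"])
  have "t *\<^sub>R z - (t *\<^sub>R z + s *\<^sub>R (t *\<^sub>R x - t *\<^sub>R z)) = (s * t) *\<^sub>R (z - x)"
    by (simp add: algebra_simps)
  then have "infnorm (t *\<^sub>R z - (t *\<^sub>R z + s *\<^sub>R (t *\<^sub>R x - t *\<^sub>R z))) = s * t * infnorm (z - x)"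
    using s t by (simp add: infnorm_mul abs_mult)
  also have "\<dots> \<le> 1 * infnorm (z - x)"
    using s t by (intro mult_right_mono mult_le_one infnorm_pos_le)
  finally show ?thesis
    using s x by (auto simp: mem_linf_nbhd_sphere intro!: exI[of _ "t *\<^sub>R z + s *\<^sub>R (t *\<^sub>R x - t *\<^sub>R z)"])
qed

lemma linf_nbhd_sphere_homotopy_eqv_disk:
  "linf_nbhd r linf_sphere (UNIV :: (real ^ 'n) set) homotopy_eqv
   linf_nbhd r linf_sphere (linf_disk :: (real ^ 'n) set)"
    (is "?N homotopy_eqv ?D")
proof (rule linear_deformation_retract_imp_homotopy_eqv)
  \<comment> \<open>Nearest-point projection to the Euclidean unit ball; \<open>max 1\<close> makes
    it the identity on the disk and keeps it continuous at 0.\<close>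
  let ?f = "\<lambda>z :: real ^ 'n. (1 / max 1 (norm z)) *\<^sub>R z"
  \<comment> \<open>These \<open>t\<close> sweep the segment from \<open>z\<close> to
    \<open>?f z\<close>. In the disk they are only \<open>t = 1\<close>; outside it the lower bound
    says exactly that \<open>t *\<^sub>R z\<close> has norm at least 1.\<close>
  have seg: "t *\<^sub>R z \<in> ?N" if "z \<in> ?N" "1 / max 1 (norm z) \<le> t" "t \<le> 1" for z t
  proof (cases "norm z \<le> 1")
    case True
    then show ?thesis
      using that by (simp add: max_def split: if_splits)
  next
    case False
    then have z: "norm z > 1"
      by simp
    with that have "1 / norm z \<le> t"
      by (simp add: max_def)
    moreover from this z have "0 \<le> t"
      by (smt (verit) divide_nonneg_nonneg)
    moreover from \<open>1 / norm z \<le> t\<close> z have "1 \<le> t * norm z"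
      using pos_divide_le_eq[of "norm z" 1 t] by linarith
    ultimately show ?thesis
      using that by (intro scaleR_mem_linf_nbhd_sphere) simp_all
  qed
  show "?D \<subseteq> ?N"
    by (auto simp: mem_linf_nbhd_sphere)
  show "continuous_on ?N ?f"
    by (intro continuous_intros) auto
  show "?f \<in> ?N \<rightarrow> ?D"
  proof
    fix z assume "z \<in> ?N"
    then have "?f z \<in> ?N"
      by (rule seg) auto
    moreover have "norm (?f z) \<le> 1"
      by (simp add: divide_le_eq)
    ultimately show "?f z \<in> ?D"
      by (simp add: mem_linf_nbhd_sphere linf_disk_eq)
  qed
  show "?f z = z" if "z \<in> ?D" for z
    using that by (auto simp: mem_linf_nbhd_sphere linf_disk_eq max_def)
  show "closed_segment z (?f z) \<subseteq> ?N" if "z \<in> ?N" for z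
  proof
    fix y assume "y \<in> closed_segment z (?f z)"
    then obtain t where t: "y = t *\<^sub>R z" "min 1 (1 / max 1 (norm z)) \<le> t" "t \<le> max 1 (1 / max 1 (norm z))"
      by (rule mem_segment_to_multiple)
    moreover have "1 / max 1 (norm z) \<le> 1"
      by auto
    ultimately show "y \<in> ?N"
      using seg[OF that, of t] by (simp add: min_absorb2 max_absorb1)
  qed
qed

section \<open>The neighbourhood within the disk as the complement of \<open>V\<close>\<close>

lemma signed_vertex:
  fixes z :: "real ^ 'n"
  assumes "r \<ge> 0"
  obtains p where "\<And>i. p $ i \<in> {r, -r}" "\<And>i. \<bar>z $ i - p $ i\<bar> = \<bar>z $ i\<bar> + r"
proof
  \<comment> \<open>Signs opposite to those of \<open>z\<close> pick the vertex farthest from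
    \<open>z\<close>, with no cancellation in any coordinate.\<close>
  let ?p = "\<chi> i. if z $ i \<ge> 0 then - r else r"
  show "?p $ i \<in> {r, -r}" "\<bar>z $ i - ?p $ i\<bar> = \<bar>z $ i\<bar> + r" for i
    using assms by auto
qed

lemma linf_nbhd_sphere_disk_eq:
  assumes "r > 0"
  shows "linf_nbhd r linf_sphere (linf_disk :: (real ^ 'n) set) = linf_disk - V r"
proof (intro equalityI subsetI)
  fix z :: "real ^ 'n"
  assume "z \<in> linf_nbhd r linf_sphere linf_disk"
  then obtain x where z: "z \<in> linf_disk" and x: "norm x = 1" "infnorm (z - x) < r"
    by (auto simp: mem_linf_nbhd_sphere)
  obtain p where p: "\<And>i. p $ i \<in> {r, -r}" "\<And>i. \<bar>z $ i - p $ i\<bar> = \<bar>z $ i\<bar> + r"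
    using signed_vertex[of r z] assms by auto
  \<comment> \<open>Coordinatewise triangle inequality: \<open>x $ i\<close> differs from
    \<open>z $ i\<close> by less than \<open>r\<close>. Hence the vertex \<open>z - p\<close> is
    strictly longer than the unit vector \<open>x\<close>.\<close>
  have lt: "\<bar>x $ i\<bar> < \<bar>(z - p) $ i\<bar>" for i
    using component_le_infnorm_cart[of "z - x" i] x(2) p(2)[of i] by simp
  have "(norm x)\<^sup>2 < (norm (z - p))\<^sup>2"
    unfolding norm_sq_cart
    by (rule sum_strict_mono) (use lt in \<open>auto, metis abs_ge_zero pos2 power2_abs power_strict_mono\<close>)
  then have "z \<notin> V r"
    using p(1) x(1) by (auto simp: V_iff power2_less_imp_less abs_square_le_1 simp flip: not_le)
  with z show "z \<in> linf_disk - V r"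
    by simp
next
  fix z :: "real ^ 'n"
  assume "z \<in> linf_disk - V r"
  then obtain p where z: "norm z \<le> 1" and p: "\<And>i. p $ i \<in> {r, -r}" "norm (z - p) > 1"
    by (auto simp: V_iff linf_disk_eq not_le)
  \<comment> \<open>The sphere point near \<open>z\<close> is taken on the segment from the vertex
    \<open>z - p\<close>, outside the disk, to \<open>z\<close>, inside it. As the vertex is
    strictly outside, \<open>s\<close> is positive, which makes the final bound
    \<open>(1 - s) * r\<close> strictly less than \<open>r\<close>.\<close>
  obtain s where s: "0 \<le> s" "s \<le> 1" "norm (z - p + s *\<^sub>R (z - (z - p))) = 1"
    using z p by (auto intro: norm_eq_1_on_segment[of z "z - p"])
  have "s \<noteq> 0"
    using s p by auto
  have "infnorm p \<le> r"
    using p(1) assms by (intro infnorm_le_cart) (smt (verit) insert_iff singletonD)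
  have "z - (z - p + s *\<^sub>R (z - (z - p))) = (1 - s) *\<^sub>R p"
    by (simp add: algebra_simps)
  then have "infnorm (z - (z - p + s *\<^sub>R (z - (z - p)))) = (1 - s) * infnorm p"
    using s by (simp add: infnorm_mul)
  also have "\<dots> \<le> (1 - s) * r"
    using s \<open>infnorm p \<le> r\<close> by (intro mult_left_mono) auto
  also have "\<dots> < r"
    using s \<open>s \<noteq> 0\<close> assms by simp
  finally show "z \<in> linf_nbhd r linf_sphere linf_disk"
    using z s(3) unfolding mem_linf_nbhd_sphere linf_disk_eq by auto
qed

section \<open>The two ranges of the radius\<close>

lemma V_empty:
  assumes "r > 1 / sqrt (real CARD('n))"
  shows "V r = ({} :: (real ^ 'n) set)"
proof (rule equals0I)
  fix z :: "real ^ 'n"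
  assume "z \<in> V r"
  have r: "r > 0"
    using assms by (rule order.strict_trans1[rotated]) simp
  obtain p where p: "\<And>i. p $ i \<in> {r, -r}" "\<And>i. \<bar>z $ i - p $ i\<bar> = \<bar>z $ i\<bar> + r"
    using signed_vertex[of r z] r by auto
  have "(1 / sqrt (real CARD('n)))\<^sup>2 < r\<^sup>2"
    using assms by (intro power_strict_mono) auto
  then have "1 < (\<Sum>i\<in>(UNIV :: 'n set). r\<^sup>2)"
    by (simp add: power_divide field_simps)
  \<comment> \<open>Every coordinate of \<open>z - p\<close> has absolute value at least
    \<open>r\<close>, by the choice of \<open>p\<close>.\<close>
  also have "\<dots> \<le> (\<Sum>i\<in>UNIV. ((z - p) $ i)\<^sup>2)"
    using p(2) r by (intro sum_mono) (auto simp flip: abs_le_square_iff)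
  also have "\<dots> = (norm (z - p))\<^sup>2"
    by (rule norm_sq_cart[symmetric])
  also have "\<dots> \<le> 1"
    using \<open>z \<in> V r\<close> p(1) by (simp add: V_iff abs_square_le_1)
  finally show False
    by simp
qed

lemma zero_in_V:
  assumes "0 < r" "r \<le> 1 / sqrt (real CARD('n))"
  shows "(0 :: real ^ 'n) \<in> V r"
  unfolding V_iff
proof (intro allI impI)
  fix p :: "real ^ 'n"
  assume p: "\<forall>i. p $ i \<in> {r, -r}"
  have "(p $ i)\<^sup>2 = r\<^sup>2" for i
    using p by (smt (verit) insertE power2_minus singletonD)
  then have "(norm p)\<^sup>2 = real CARD('n) * r\<^sup>2"
    by (simp add: norm_sq_cart)
  also have "\<dots> \<le> real CARD('n) * (1 / sqrt (real CARD('n)))\<^sup>2"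
    using assms by (intro mult_left_mono power_mono) auto
  also have "\<dots> = 1"
    by (simp add: power_divide)
  finally show "norm (0 - p) \<le> 1"
    by (simp add: abs_square_le_1)
qed

lemma disk_minus_V_homotopy_eqv_sphere:
  assumes "0 < r" "r \<le> 1 / sqrt (real CARD('n))"
  shows "(linf_disk - V r :: (real ^ 'n) set) homotopy_eqv sphere (0 :: real ^ 'n) 1"
    (is "?D homotopy_eqv _")
proof (rule linear_deformation_retract_imp_homotopy_eqv)
  let ?f = "\<lambda>z :: real ^ 'n. (1 / norm z) *\<^sub>R z"
  have 0: "(0 :: real ^ 'n) \<in> V r"
    using assms by (rule zero_in_V)
  then have nz: "z \<noteq> 0" if "z \<in> ?D" for z
    using that by auto
  \<comment> \<open>That the sphere avoids \<open>V r\<close> follows from the description of the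
    neighbourhood: a sphere point is at distance 0 from itself.\<close>
  have "x \<in> linf_nbhd r linf_sphere (linf_disk :: (real ^ 'n) set)" if "norm x = 1" for x
    unfolding mem_linf_nbhd_sphere
    using that assms by (intro conjI exI[of _ x]) (auto simp: linf_disk_eq infnorm_0)
  then show "sphere 0 1 \<subseteq> ?D"
    unfolding linf_nbhd_sphere_disk_eq[OF assms(1)] by auto
  show "continuous_on ?D ?f"
    using nz by (intro continuous_intros) auto
  show "?f \<in> ?D \<rightarrow> sphere 0 1"
    using nz by auto
  show "?f z = z" if "z \<in> sphere 0 1" for z
    using that by simp
  show "closed_segment z (?f z) \<subseteq> ?D" if "z \<in> ?D" for z
  proof
    fix y assume y: "y \<in> closed_segment z (?f z)"
    have z: "0 < norm z" "norm z \<le> 1"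
      using nz[OF that] that by (auto simp: linf_disk_eq)
    then have "1 \<le> 1 / norm z"
      by simp
    then obtain t where t: "y = t *\<^sub>R z" "1 \<le> t" "t \<le> 1 / norm z"
      using mem_segment_to_multiple[OF y] by (metis max.absorb2 min.absorb1)
    have "y \<notin> V r"
    proof
      assume "y \<in> V r"
      have "convex (V r :: (real ^ 'n) set)"
        unfolding V_eq by (intro convex_INT convex_cball)
      \<comment> \<open>As \<open>t\<close> is at least 1, the point \<open>z\<close> lies between 0
        and \<open>y\<close>; so if \<open>y\<close> were in \<open>V r\<close>, convexity would put
        \<open>z\<close> there too.\<close>
      then have "(1 / t) *\<^sub>R y + (1 - 1 / t) *\<^sub>R 0 \<in> V r"
        using \<open>y \<in> V r\<close> 0 t by (intro convexD) auto
      then show False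
        using that t by simp
    qed
    moreover have "norm y \<le> 1"
      using t z by (simp add: field_simps)
    ultimately show "y \<in> ?D"
      by (simp add: linf_disk_eq)
  qed
qed

theorem theorem12:
  fixes r :: real
  assumes "r > 0"
  shows
    "linf_topology (linf_nbhd r linf_sphere (UNIV :: (real ^ 'n) set))
       homotopy_equivalent_space
       linf_topology (linf_nbhd r linf_sphere (linf_disk :: (real ^ 'n) set)) \<and>
     linf_nbhd r linf_sphere (linf_disk :: (real ^ 'n) set) = linf_disk - V r \<and>
     (r > 1 / sqrt (real CARD('n)) \<longrightarrow>
       V r = ({} :: (real ^ 'n) set) \<and>
       linf_nbhd r linf_sphere (linf_disk :: (real ^ 'n) set) = linf_disk) \<and>
     (r \<le> 1 / sqrt (real CARD('n)) \<longrightarrow>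
       linf_topology (linf_nbhd r linf_sphere (UNIV :: (real ^ 'n) set))
         homotopy_equivalent_space top_of_set (sphere (0 :: real ^ 'n) 1)) \<and>
     (r > 1 / sqrt (real CARD('n)) \<longrightarrow>
       contractible_space (linf_topology (linf_nbhd r linf_sphere (UNIV :: (real ^ 'n) set))))"
proof (intro conjI impI)
  let ?N = "linf_nbhd r linf_sphere (UNIV :: (real ^ 'n) set)"
  let ?D = "linf_nbhd r linf_sphere (linf_disk :: (real ^ 'n) set)"
  have N: "?N homotopy_eqv ?D"
    by (rule linf_nbhd_sphere_homotopy_eqv_disk)
  then show "linf_topology ?N homotopy_equivalent_space linf_topology ?D"
    by (simp add: linf_topology_eq)
  show D: "?D = linf_disk - V r"
    using assms by (rule linf_nbhd_sphere_disk_eq)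
  show "linf_topology ?N homotopy_equivalent_space top_of_set (sphere (0 :: real ^ 'n) 1)"
    if "r \<le> 1 / sqrt (real CARD('n))"
    using homotopy_eqv_trans[OF N] disk_minus_V_homotopy_eqv_sphere[OF assms that]
    by (simp add: linf_topology_eq D)
  assume r: "r > 1 / sqrt (real CARD('n))"
  show V: "V r = ({} :: (real ^ 'n) set)"
    using r by (rule V_empty)
  show D': "?D = linf_disk"
    by (simp add: D V)
  have "contractible (linf_disk :: (real ^ 'n) set)"
    by (simp add: linf_disk_eq convex_imp_contractible)
  then show "contractible_space (linf_topology ?N)"
    using homotopy_equivalent_space_contractibility[OF N] by (simp add: linf_topology_eq D')
qed

end
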